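(* Let $q=p^l$ where $p$ is an odd prime and $l\ge 1$, and let $d$ be a positive integer with $4\mid d$. Let $E\subset \mathbb{F}_q^d$. If $$|E|>\frac{q^{d-1}}{d}\binom{d}{d/2}\binom{d/2}{d/4},$$ then for every even integer $r$ with $0\le r\le d$ there exist $x,y\in E$ with $|x-y|=r$, where $|x-y|$ denotes the Hamming distance.
   Context: $\mathbb{F}_q$ is the finite field with $q$ elements. For $x=(x_1,\dots,x_d), y=(y_1,\dots,y_d)\in\mathbb{F}_q^d$, the Hamming distance $|x-y|$ is the number of indices $i\in\{1,\dots,d\}$ with $x_i\neq y_i$. "The points of $E$ determine a Hamming distance $r$" means there are $x,y\in E$ with $|x-y|=r$. *)

theory Defs
  imports "HOL-Analysis.Finite_Cartesian_Product" "HOL-Computational_Algebra.Primes"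
begin

definition hamming_dist :: "'a ^ 'n \<Rightarrow> 'a ^ 'n \<Rightarrow> nat" where
  "hamming_dist x y = card {i. x $ i \<noteq> y $ i}"

end

theory Submission
  imports Defs
begin

text \<open>
  For a set \<open>S\<close> of \<open>r > 0\<close> coordinates, any two points on a line in the direction of the
  indicator vector of \<open>S\<close> have Hamming distance \<open>r\<close>. These lines partition the space into
  \<open>q ^ (d - 1)\<close> classes, so more than \<open>q ^ (d - 1)\<close> points determine every distance.
  The hypothesis of the theorem is stronger, since the central binomial coefficient is at
  least \<open>d\<close>.
\<close>

lemma hamming_dist_determined:
  fixes E :: "('a::{ring_1, finite} ^ 'n::finite) set"
  assumes "CARD('a) ^ (CARD('n) - 1) < card E" and "r \<le> CARD('n)"
  shows "\<exists>x\<in>E. \<exists>y\<in>E. hamming_dist x y = r"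
proof -
  obtain S :: "'n set" where S: "card S = r"
    using assms(2) by (meson obtain_subset_with_card_n)
  \<comment> \<open>A collision of \<open>f\<close> on \<open>E \<times> UNIV\<close> replaces the
    pigeonhole on lines, so no representatives of the lines are chosen.\<close>
  define f :: "('a ^ 'n) \<times> 'a \<Rightarrow> 'a ^ 'n"
    where "f = (\<lambda>(x, t). \<chi> i. x $ i + (if i \<in> S then t else 0))"
  have "CARD('a ^ 'n) = CARD('a) ^ (CARD('n) - 1) * CARD('a)"
    by (metis CARD_vec mult.commute power_eq_if zero_less_card_finite less_irrefl)
  also have "\<dots> < card E * CARD('a)"
    using assms(1) by simp
  also have "\<dots> = card (E \<times> (UNIV :: 'a set))"
    by (simp add: card_cartesian_product)
  finally have "\<not> inj_on f (E \<times> UNIV)"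
    by (metis card_inj_on_le finite subset_UNIV not_less)
  then obtain x y s t where xy: "x \<in> E" "y \<in> E" "(x, s) \<noteq> (y, t)" "f (x, s) = f (y, t)"
    by (auto simp: inj_on_def)
  have eq: "x $ i + (if i \<in> S then s else 0) = y $ i + (if i \<in> S then t else 0)" for i
    using xy(4) by (auto simp: f_def vec_eq_iff)
  \<comment> \<open>Equal parameters would cancel and force \<open>x = y\<close>. Hence
    \<open>x - y\<close> is the nonzero scalar \<open>t - s\<close> on \<open>S\<close> and zero
    elsewhere. For \<open>r = 0\<close> the set \<open>S\<close> is empty and the collision has
    \<open>x = y\<close>, so this case needs no separate treatment.\<close>
  have "s \<noteq> t"
    using xy(3) eq by (auto simp: vec_eq_iff)
  have "x $ i \<noteq> y $ i \<longleftrightarrow> i \<in> S" for i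
    using eq[of i] \<open>s \<noteq> t\<close> by (auto split: if_splits)
  then have "hamming_dist x y = r"
    using S by (simp add: hamming_dist_def)
  then show ?thesis
    using xy by blast
qed

theorem theorem1:
  fixes p l q d :: nat
    and E :: "('a::{field, finite} ^ 'n::finite) set"
  assumes "prime p" and "odd p" and "l \<ge> 1" and "q = p ^ l"
    and "CARD('a) = q"
    and "CARD('n) = d"
    and "d > 0" and "4 dvd d"
    and "real (card E) > real q ^ (d - 1) / real d
           * real (d choose (d div 2)) * real ((d div 2) choose (d div 4))"
  shows "\<forall>r. even r \<and> r \<le> d \<longrightarrow> (\<exists>x\<in>E. \<exists>y\<in>E. hamming_dist x y = r)"
proof -
  \<comment> \<open>The central coefficient is compared with \<open>d choose 1 = d\<close>.\<close>
  have "d \<le> d choose (d div 2)"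
    using binomial_maximum[of d 1] by simp
  moreover have "1 \<le> (d div 2) choose (d div 4)"
    by (simp add: Suc_le_eq zero_less_binomial_iff div_le_mono2)
  ultimately have "d * 1 \<le> (d choose (d div 2)) * ((d div 2) choose (d div 4))"
    by (rule mult_le_mono)
  then have "real d \<le> real (d choose (d div 2)) * real ((d div 2) choose (d div 4))"
    by (metis mult_1_right of_nat_le_iff of_nat_mult)
  then have "real q ^ (d - 1) / real d * real d \<le> real q ^ (d - 1) / real d
      * (real (d choose (d div 2)) * real ((d div 2) choose (d div 4)))"
    by (rule mult_left_mono) simp
  also have "\<dots> < real (card E)"
    using assms(9) by (simp add: mult.assoc)
  finally have "real (q ^ (d - 1)) < real (card E)"
    using \<open>d > 0\<close> by simp
  then have "q ^ (d - 1) < card E"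
    by (simp only: of_nat_less_iff)
  then show ?thesis
    using hamming_dist_determined[of E] assms(5,6) by blast
qed

end
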